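(* Let $M=(M,d)$ be a global NPC space, let $x_1,\dots,x_m,y_1,\dots,y_n\in M$, let $\lambda_1,\dots,\lambda_m\in[0,1]$ with $\sum_{i=1}^m\lambda_i=1$, and let $\mu_1,\dots,\mu_n$ be real weights. Suppose that $$\sum_{i=1}^{m}\lambda_{i}\delta_{x_{i}}\prec\sum_{j=1}^{n}\mu_{j}\delta_{y_{j}}$$ in $M$. Then for every convex subset $U\subset M$ containing all the points $x_i$ and $y_j$, and every continuous convex function $f:U\to\mathbb{R}$, $$\sum_{i=1}^{m}\lambda_{i}f(x_{i})\leq\sum_{j=1}^{n}\mu_{j}f(y_{j}).$$
   Context: A global NPC space is a complete metric space $M=(M,d)$ such that for each pair $x_0,x_1\in M$ there is $y\in M$ with $d^2(z,y)\le \frac12 d^2(z,x_0)+\frac12 d^2(z,x_1)-\frac14 d^2(x_0,x_1)$ for all $z\in M$. In such a space any two points $x_0,x_1$ are joined by a unique geodesic $\gamma:[0,1]\to M$ (parametrized proportionally to arc length, so $d(\gamma(s),\gamma(t))=|s-t|\,d(x_0,x_1)$). A set $C\subset M$ is convex if $\gamma([0,1])\subset C$ for each geodesic $\gamma:[0,1]\to M$ with $\gamma(0),\gamma(1)\in C$. A function $\varphi:C\to\mathbb{R}$ is convex if $C$ is convex and $\varphi(\gamma(t))\le(1-t)\varphi(\gamma(0))+t\varphi(\gamma(1))$ for every geodesic $\gamma:[0,1]\to C$ and $t\in[0,1]$. Majorization: the relation $\sum_{i=1}^{m}\lambda_{i}\delta_{x_{i}}\prec\sum_{j=1}^{n}\mu_{j}\delta_{y_{j}}$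 means that there exists a real $m\times n$ matrix $A=(a_{ij})$ with $a_{ij}\ge0$ for all $i,j$, $\sum_{j=1}^n a_{ij}=1$ for each $i$, $\mu_j=\sum_{i=1}^m a_{ij}\lambda_i$ for each $j$, and, for each $i=1,\dots,m$, $$x_i=\arg\min_{z\in M}\frac12\sum_{j=1}^n a_{ij}d^2(z,y_j)$$ (in a global NPC space this minimizer exists and is unique). *)

theory Defs
  imports "HOL-Analysis.Analysis"
begin

class global_NPC_space = complete_space +
  assumes NPC_inequality:
    "\<exists>y. \<forall>z. (dist z y)\<^sup>2 \<le> 1/2 * (dist z x0)\<^sup>2 + 1/2 * (dist z x1)\<^sup>2 - 1/4 * (dist x0 x1)\<^sup>2"

text \<open>
  Geodesics are parametrized on the unit interval, proportionally to arc length;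
  the values of \<open>\<gamma>\<close> outside \<open>{0..1}\<close> are irrelevant.
\<close>

definition geodesic :: "(real \<Rightarrow> 'a::metric_space) \<Rightarrow> bool" where
  "geodesic \<gamma> \<longleftrightarrow>
     (\<forall>s\<in>{0..1}. \<forall>t\<in>{0..1}. dist (\<gamma> s) (\<gamma> t) = \<bar>s - t\<bar> * dist (\<gamma> 0) (\<gamma> 1))"

definition geodesically_convex :: "'a::metric_space set \<Rightarrow> bool" where
  "geodesically_convex C \<longleftrightarrow>
     (\<forall>\<gamma>. geodesic \<gamma> \<longrightarrow> \<gamma> 0 \<in> C \<longrightarrow> \<gamma> 1 \<in> C \<longrightarrow> \<gamma> ` {0..1} \<subseteq> C)"

definition geodesically_convex_on :: "'a::metric_space set \<Rightarrow> ('a \<Rightarrow> real) \<Rightarrow> bool" where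
  "geodesically_convex_on C \<phi> \<longleftrightarrow>
     geodesically_convex C \<and>
     (\<forall>\<gamma>. geodesic \<gamma> \<longrightarrow> \<gamma> ` {0..1} \<subseteq> C \<longrightarrow>
        (\<forall>t\<in>{0..1}. \<phi> (\<gamma> t) \<le> (1 - t) * \<phi> (\<gamma> 0) + t * \<phi> (\<gamma> 1)))"

text \<open>
  \<open>majorized m lam x n mu y\<close> renders
  \<open>lam\<^sub>1\<delta>(x\<^sub>1) + \<dots> + lam\<^sub>m\<delta>(x\<^sub>m) \<prec> mu\<^sub>1\<delta>(y\<^sub>1) + \<dots> + mu\<^sub>n\<delta>(y\<^sub>n)\<close>. It is a relation between
  the finite families of weights and points, not between the measures they define:
  points may repeat. Only the entries with indices in \<open>{1..m}\<close> resp. \<open>{1..n}\<close> matter.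
  The minimizer is unique in a global NPC space, so there \<open>is_arg_min\<close> determines
  each \<open>x i\<close>.
\<close>

definition majorized ::
  "nat \<Rightarrow> (nat \<Rightarrow> real) \<Rightarrow> (nat \<Rightarrow> 'a::metric_space) \<Rightarrow>
   nat \<Rightarrow> (nat \<Rightarrow> real) \<Rightarrow> (nat \<Rightarrow> 'a) \<Rightarrow> bool" where
  "majorized m lam x n mu y \<longleftrightarrow>
     (\<exists>a :: nat \<Rightarrow> nat \<Rightarrow> real.
        (\<forall>i\<in>{1..m}. \<forall>j\<in>{1..n}. a i j \<ge> 0) \<and>
        (\<forall>i\<in>{1..m}. (\<Sum>j=1..n. a i j) = 1) \<and>
        (\<forall>j\<in>{1..n}. mu j = (\<Sum>i=1..m. a i j * lam i)) \<and>
        (\<forall>i\<in>{1..m}.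
           is_arg_min (\<lambda>z. 1/2 * (\<Sum>j=1..n. a i j * (dist z (y j))\<^sup>2)) (\<lambda>z. z \<in> UNIV) (x i)))"

end

theory Submission
  imports Defs
begin

text \<open>
  Majorization reduces the claim to Jensen's inequality \<open>f b \<le> F := \<Sum> a\<^sub>j f(y\<^sub>j)\<close> for a barycenter
  \<open>b\<close> of points \<open>y\<^sub>j\<close> with weights \<open>a\<^sub>j\<close>. Since \<open>U\<close> need not be closed, one cannot project onto
  the epigraph of \<open>f\<close>. Instead, take \<open>p\<close> to be the infimum of \<open>d\<^sup>2(z,b) + (s - F)\<^sup>2\<close> over all
  \<open>(z,s)\<close> in the epigraph. Moving \<open>(z,s)\<close> by a fraction \<open>t\<close> towards \<open>(y\<^sub>j, f(y\<^sub>j))\<close> stays in the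
  epigraph, and by the variance inequality the \<open>a\<close>-average over \<open>j\<close> of the new values is at most
  \<open>(1-t)\<^sup>2\<close> times the old value plus \<open>t\<^sup>2 C\<close>. Hence \<open>p \<le> (1-t)\<^sup>2 p + t\<^sup>2 C\<close>, which forces \<open>p = 0\<close>
  as \<open>t \<rightarrow> 0\<close>, and continuity of \<open>f\<close> at \<open>b\<close> gives \<open>f b \<le> F\<close>.
\<close>

section \<open>Intermediate points and geodesics in global NPC spaces\<close>

text \<open>The point at parameter \<open>t\<close> between \<open>x0\<close> and \<open>x1\<close>
  is described by distances alone, without a curve. In Euclidean space the inequality is Stewart's
  identity. For \<open>t = 1/2\<close>, existence of \<open>y\<close> is the class axiom.\<close>

definition NPC_between :: "'a::metric_space \<Rightarrow> 'a \<Rightarrow> real \<Rightarrow> 'a \<Rightarrow> bool" where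
  "NPC_between x0 x1 t y \<longleftrightarrow>
     (\<forall>z. (dist z y)\<^sup>2 \<le> (1 - t) * (dist z x0)\<^sup>2 + t * (dist z x1)\<^sup>2 - t * (1 - t) * (dist x0 x1)\<^sup>2)"

lemma NPC_between_0 [simp]: "NPC_between x0 x1 0 y \<longleftrightarrow> y = x0"
  unfolding NPC_between_def by (auto dest: spec[of _ x0])

lemma NPC_between_1 [simp]: "NPC_between x0 x1 1 y \<longleftrightarrow> y = x1"
  unfolding NPC_between_def by (auto dest: spec[of _ x1])

text \<open>Testing \<open>u\<close> against \<open>x0\<close> and \<open>x1\<close> bounds its
  distances to them; testing \<open>v\<close> against \<open>u\<close> then suffices because
  \<open>(1 - t) * s^2 + t * (1 - s)^2 - t * (1 - t) = (s - t)^2\<close>.\<close>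

lemma NPC_between_dist_le:
  assumes "NPC_between x0 x1 s u" "NPC_between x0 x1 t v" "s \<in> {0..1}" "t \<in> {0..1}"
  shows "dist u v \<le> \<bar>s - t\<bar> * dist x0 x1"
proof -
  have 0: "(dist u x0)\<^sup>2 \<le> s\<^sup>2 * (dist x0 x1)\<^sup>2"
    using assms(1) unfolding NPC_between_def
    by (auto dest!: spec[of _ x0] simp: dist_commute algebra_simps power2_eq_square)
  have 1: "(dist u x1)\<^sup>2 \<le> (1 - s)\<^sup>2 * (dist x0 x1)\<^sup>2"
    using assms(1) unfolding NPC_between_def
    by (auto dest!: spec[of _ x1] simp: dist_commute algebra_simps power2_eq_square)
  have "(dist u v)\<^sup>2 \<le> (1 - t) * (dist u x0)\<^sup>2 + t * (dist u x1)\<^sup>2 - t * (1 - t) * (dist x0 x1)\<^sup>2"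
    using assms(2) unfolding NPC_between_def by blast
  also have "\<dots> \<le> (1 - t) * (s\<^sup>2 * (dist x0 x1)\<^sup>2) + t * ((1 - s)\<^sup>2 * (dist x0 x1)\<^sup>2)
      - t * (1 - t) * (dist x0 x1)\<^sup>2"
    using assms(4) by (intro diff_right_mono add_mono mult_left_mono 0 1) auto
  also have "\<dots> = (\<bar>s - t\<bar> * dist x0 x1)\<^sup>2"
    by (simp add: power_mult_distrib) (simp add: power2_eq_square algebra_simps)
  finally show ?thesis
    by (rule power2_le_imp_le) simp
qed

text \<open>For \<open>s <= t\<close>, the upper bounds on the legs from \<open>x0\<close> to
  \<open>u\<close> and from \<open>v\<close> to \<open>x1\<close> leave, by the triangle inequality,
  at least \<open>(t - s) * dist x0 x1\<close> for the leg from \<open>u\<close> to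
  \<open>v\<close>.\<close>

lemma NPC_between_dist:
  assumes "NPC_between x0 x1 s u" "NPC_between x0 x1 t v" "s \<in> {0..1}" "t \<in> {0..1}"
  shows "dist u v = \<bar>s - t\<bar> * dist x0 x1"
proof -
  have *: "(t - s) * dist x0 x1 \<le> dist u v"
    if "NPC_between x0 x1 s u" "NPC_between x0 x1 t v" "s \<in> {0..1}" "t \<in> {0..1}" for s t u v
  proof -
    have "dist x0 u \<le> s * dist x0 x1" "dist v x1 \<le> (1 - t) * dist x0 x1"
      using NPC_between_dist_le[of x0 x1 0 x0 s u] NPC_between_dist_le[of x0 x1 t v 1 x1] that
      by auto
    moreover have "dist x0 x1 \<le> dist x0 u + dist u v + dist v x1"
      using dist_triangle[of x0 x1 u] dist_triangle[of u x1 v] by linarith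
    ultimately show ?thesis
      by (simp add: algebra_simps)
  qed
  have "\<bar>s - t\<bar> * dist x0 x1 \<le> dist u v"
    using *[of s u t v] *[of t v s u] assms by (auto simp: abs_if dist_commute)
  with NPC_between_dist_le[OF assms] show ?thesis
    by simp
qed

text \<open>The midpoint of \<open>u\<close> and \<open>v\<close> works: with
  \<open>dist u v\<close> known exactly, the average of \<open>s * (1 - s)\<close> and
  \<open>t * (1 - t)\<close> plus \<open>(s - t)^2 / 4\<close> is \<open>r * (1 - r)\<close> for
  \<open>r = (s + t) / 2\<close>.\<close>

lemma NPC_between_midpoint:
  fixes x0 x1 :: "'a::global_NPC_space"
  assumes "NPC_between x0 x1 s u" "NPC_between x0 x1 t v" "s \<in> {0..1}" "t \<in> {0..1}"
  shows "\<exists>w. NPC_between x0 x1 ((s + t) / 2) w"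
proof -
  obtain w where w: "(dist z w)\<^sup>2 \<le> 1/2 * (dist z u)\<^sup>2 + 1/2 * (dist z v)\<^sup>2 - 1/4 * (dist u v)\<^sup>2" for z
    using NPC_inequality by blast
  have uv: "(dist u v)\<^sup>2 = (s - t)\<^sup>2 * (dist x0 x1)\<^sup>2"
    by (simp add: NPC_between_dist[OF assms] power_mult_distrib)
  have "(dist z w)\<^sup>2 \<le> (1 - (s + t) / 2) * (dist z x0)\<^sup>2 + (s + t) / 2 * (dist z x1)\<^sup>2
      - (s + t) / 2 * (1 - (s + t) / 2) * (dist x0 x1)\<^sup>2" for z
  proof -
    have "(dist z u)\<^sup>2 \<le> (1 - s) * (dist z x0)\<^sup>2 + s * (dist z x1)\<^sup>2 - s * (1 - s) * (dist x0 x1)\<^sup>2"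
      "(dist z v)\<^sup>2 \<le> (1 - t) * (dist z x0)\<^sup>2 + t * (dist z x1)\<^sup>2 - t * (1 - t) * (dist x0 x1)\<^sup>2"
      using assms(1,2) unfolding NPC_between_def by blast+
    with w[of z] uv show ?thesis
      by (simp add: power2_eq_square field_simps)
  qed
  then show ?thesis
    unfolding NPC_between_def by blast
qed

text \<open>The distance formula makes the points Lipschitz in the parameter, so convergent
  parameters give a Cauchy sequence of points, and the defining inequality survives the
  limit.\<close>

lemma NPC_between_closed:
  fixes x0 x1 :: "'a::complete_space"
  shows "closed {t \<in> {0..1}. \<exists>y. NPC_between x0 x1 t y}"
  unfolding closed_sequential_limits
proof safe
  fix \<tau> t
  assume \<tau>: "\<forall>n. \<tau> n \<in> {t \<in> {0..1}. \<exists>y. NPC_between x0 x1 t y}" and lim: "\<tau> \<longlonglongrightarrow> t"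
  have "\<tau> n \<in> {0..1}" for n
    using \<tau> by blast
  then show t: "t \<in> {0..1}"
    using closed_sequentially[OF closed_atLeastAtMost _ lim] by blast
  have "\<forall>n. \<exists>y. NPC_between x0 x1 (\<tau> n) y"
    using \<tau> by blast
  from choice[OF this] obtain Y where Y: "NPC_between x0 x1 (\<tau> n) (Y n)" for n
    by blast
  have dist_Y: "dist (Y k) (Y l) = dist (\<tau> k) (\<tau> l) * dist x0 x1" for k l
    using NPC_between_dist[OF Y Y] \<tau> by (auto simp: dist_real_def)
  have "Cauchy Y"
    unfolding Cauchy_def
  proof (intro allI impI)
    fix e :: real assume "e > 0"
    \<comment> \<open>The summand 1 keeps the denominator positive when
      \<open>x0 = x1\<close>.\<close>
    then have "e / (1 + dist x0 x1) > 0"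
      by (simp add: add_pos_nonneg)
    then obtain N where N: "\<And>k l. k \<ge> N \<Longrightarrow> l \<ge> N \<Longrightarrow> dist (\<tau> k) (\<tau> l) < e / (1 + dist x0 x1)"
      using LIMSEQ_imp_Cauchy[OF lim] unfolding Cauchy_def by blast
    have "dist (Y k) (Y l) < e" if "k \<ge> N" "l \<ge> N" for k l
    proof -
      have "dist (\<tau> k) (\<tau> l) * (1 + dist x0 x1) < e"
        using N[OF that] by (simp add: pos_less_divide_eq add_pos_nonneg)
      moreover have "dist (\<tau> k) (\<tau> l) * dist x0 x1 \<le> dist (\<tau> k) (\<tau> l) * (1 + dist x0 x1)"
        by (intro mult_left_mono) auto
      ultimately show ?thesis
        unfolding dist_Y by linarith
    qed
    then show "\<exists>N. \<forall>k\<ge>N. \<forall>l\<ge>N. dist (Y k) (Y l) < e"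
      by blast
  qed
  then obtain y where y: "Y \<longlonglongrightarrow> y"
    using Cauchy_convergent convergent_def by blast
  have "NPC_between x0 x1 t y"
    unfolding NPC_between_def
  proof
    fix z
    show "(dist z y)\<^sup>2 \<le> (1 - t) * (dist z x0)\<^sup>2 + t * (dist z x1)\<^sup>2 - t * (1 - t) * (dist x0 x1)\<^sup>2"
    proof (rule LIMSEQ_le)
      show "(\<lambda>n. (dist z (Y n))\<^sup>2) \<longlonglongrightarrow> (dist z y)\<^sup>2"
        by (intro tendsto_intros y)
      show "(\<lambda>n. (1 - \<tau> n) * (dist z x0)\<^sup>2 + \<tau> n * (dist z x1)\<^sup>2 - \<tau> n * (1 - \<tau> n) * (dist x0 x1)\<^sup>2)
          \<longlonglongrightarrow> (1 - t) * (dist z x0)\<^sup>2 + t * (dist z x1)\<^sup>2 - t * (1 - t) * (dist x0 x1)\<^sup>2"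
        by (intro tendsto_intros lim)
      show "\<exists>N. \<forall>n\<ge>N. (dist z (Y n))\<^sup>2
          \<le> (1 - \<tau> n) * (dist z x0)\<^sup>2 + \<tau> n * (dist z x1)\<^sup>2 - \<tau> n * (1 - \<tau> n) * (dist x0 x1)\<^sup>2"
        using Y unfolding NPC_between_def by blast
    qed
  qed
  then show "\<exists>y. NPC_between x0 x1 t y" ..
qed

text \<open>Let \<open>l\<close> and \<open>r\<close> be the points of \<open>T\<close> in the unit
  interval nearest to \<open>t\<close> from below and above. Their midpoint is in \<open>T\<close>
  and on one side of \<open>t\<close>, so extremality forces \<open>l = r = t\<close>.\<close>

lemma closed_midpoint_unit_interval:
  fixes T :: "real set"
  assumes "closed T" "0 \<in> T" "1 \<in> T"
    and midpoint: "\<And>s t. s \<in> T \<Longrightarrow> t \<in> T \<Longrightarrow> (s + t) / 2 \<in> T"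
  shows "{0..1} \<subseteq> T"
proof
  fix t :: real assume t: "t \<in> {0..1}"
  define l where "l = Sup (T \<inter> {0..t})"
  define r where "r = Inf (T \<inter> {t..1})"
  have "l \<in> T \<inter> {0..t}"
    unfolding l_def using assms t by (intro closed_contains_Sup closed_Int) auto
  moreover have "r \<in> T \<inter> {t..1}"
    unfolding r_def using assms t by (intro closed_contains_Inf closed_Int) auto
  ultimately have lr: "l \<in> T" "r \<in> T" "0 \<le> l" "l \<le> t" "t \<le> r" "r \<le> 1"
    by auto
  have m: "(l + r) / 2 \<in> T"
    using midpoint lr by blast
  show "t \<in> T"
  proof (cases "(l + r) / 2 \<le> t")
    case True
    then have "(l + r) / 2 \<le> l"
      unfolding l_def using m lr by (intro cSup_upper) (auto simp: l_def)
    then have "r \<le> l"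
      by simp
    then have "t = l"
      using lr by simp
    then show ?thesis
      using lr by simp
  next
    case False
    then have "r \<le> (l + r) / 2"
      unfolding r_def using m lr by (intro cInf_lower) (auto simp: r_def)
    then have "r \<le> l"
      by simp
    then have "l = t"
      using lr by simp
    then show ?thesis
      using lr by simp
  qed
qed

lemma NPC_between_exists:
  fixes x0 x1 :: "'a::global_NPC_space"
  assumes "t \<in> {0..1}"
  shows "\<exists>y. NPC_between x0 x1 t y"
proof -
  have "{0..1} \<subseteq> {t \<in> {0..1}. \<exists>y. NPC_between x0 x1 t y}"
    by (intro closed_midpoint_unit_interval NPC_between_closed)
      (auto dest: NPC_between_midpoint)
  with assms show ?thesis
    by blast
qed

text \<open>By the distance formula, any choice of intermediate points is a geodesic. It links the
  convexity hypotheses, which speak of geodesics, with the NPC inequality kept in the last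
  conclusion.\<close>

lemma NPC_geodesic_exists:
  fixes x0 x1 :: "'a::global_NPC_space"
  obtains \<gamma> where "geodesic \<gamma>" "\<gamma> 0 = x0" "\<gamma> 1 = x1"
    "\<And>t. t \<in> {0..1} \<Longrightarrow> NPC_between x0 x1 t (\<gamma> t)"
proof -
  have "\<forall>t\<in>{0..1}. \<exists>y. NPC_between x0 x1 t y"
    using NPC_between_exists by blast
  from bchoice[OF this] obtain \<gamma> where \<gamma>: "\<And>t. t \<in> {0..1} \<Longrightarrow> NPC_between x0 x1 t (\<gamma> t)"
    by blast
  have ends: "\<gamma> 0 = x0" "\<gamma> 1 = x1"
    using \<gamma>[of 0] \<gamma>[of 1] by auto
  have "geodesic \<gamma>"
    unfolding geodesic_def ends using NPC_between_dist[OF \<gamma> \<gamma>] by blast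
  with ends \<gamma> that show thesis
    by blast
qed

section \<open>Barycenters: variance inequality and Jensen's inequality\<close>

text \<open>Compare \<open>b\<close> with the point \<open>w\<close> at fraction \<open>t\<close> of
  the way to \<open>z\<close>. Minimality and the NPC inequality for \<open>w\<close> give a bound
  divisible by \<open>t\<close>; divide and let \<open>t\<close> tend to 0.\<close>

lemma variance_inequality:
  fixes b z :: "'a::global_NPC_space" and y :: "'i \<Rightarrow> 'a"
  assumes a: "\<And>j. j \<in> J \<Longrightarrow> 0 \<le> a j" "(\<Sum>j\<in>J. a j) = 1"
    and min: "\<And>w. (\<Sum>j\<in>J. a j * (dist b (y j))\<^sup>2) \<le> (\<Sum>j\<in>J. a j * (dist w (y j))\<^sup>2)"
  shows "(dist z b)\<^sup>2 + (\<Sum>j\<in>J. a j * (dist b (y j))\<^sup>2) \<le> (\<Sum>j\<in>J. a j * (dist z (y j))\<^sup>2)"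
proof -
  define V where "V w = (\<Sum>j\<in>J. a j * (dist w (y j))\<^sup>2)" for w
  have *: "V b + (1 - t) * (dist z b)\<^sup>2 \<le> V z" if t: "0 < t" "t \<le> 1" for t
  proof -
    obtain w where w: "NPC_between b z t w"
      using NPC_between_exists[of t b z] t by auto
    have "V b \<le> V w"
      using min by (simp add: V_def)
    also have "V w \<le> (\<Sum>j\<in>J. a j * ((1 - t) * (dist b (y j))\<^sup>2 + t * (dist z (y j))\<^sup>2
        - t * (1 - t) * (dist b z)\<^sup>2))"
      unfolding V_def using w a(1)
      by (intro sum_mono mult_left_mono) (auto simp: NPC_between_def dist_commute)
    also have "\<dots> = (1 - t) * V b + t * V z - (\<Sum>j\<in>J. a j) * (t * (1 - t) * (dist b z)\<^sup>2)"
      unfolding V_def sum_distrib_left sum_distrib_right sum.distrib[symmetric] sum_subtractf[symmetric]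
      by (intro sum.cong refl) (simp add: algebra_simps)
    finally have "t * (V b + (1 - t) * (dist z b)\<^sup>2) \<le> t * V z"
      by (simp add: a(2) algebra_simps dist_commute)
    with t show ?thesis
      by simp
  qed
  have "V b + (1 - 0) * (dist z b)\<^sup>2 \<le> V z"
  proof (rule tendsto_upperbound)
    show "((\<lambda>t. V b + (1 - t) * (dist z b)\<^sup>2) \<longlongrightarrow> V b + (1 - 0) * (dist z b)\<^sup>2) (at_right 0)"
      by (intro tendsto_intros)
    show "\<forall>\<^sub>F t in at_right 0. V b + (1 - t) * (dist z b)\<^sup>2 \<le> V z"
      using * by (auto simp: eventually_at_right_field intro!: exI[of _ 1])
  qed simp
  then show ?thesis
    by (simp add: V_def)
qed

theorem NPC_Jensen:
  fixes b :: "'a::global_NPC_space" and y :: "'i \<Rightarrow> 'a"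
  assumes a: "\<And>j. j \<in> J \<Longrightarrow> 0 \<le> a j" "(\<Sum>j\<in>J. a j) = 1"
    and min: "\<And>w. (\<Sum>j\<in>J. a j * (dist b (y j))\<^sup>2) \<le> (\<Sum>j\<in>J. a j * (dist w (y j))\<^sup>2)"
    and f: "continuous_on U f" "geodesically_convex_on U f"
    and U: "b \<in> U" "\<And>j. j \<in> J \<Longrightarrow> y j \<in> U"
  shows "f b \<le> (\<Sum>j\<in>J. a j * f (y j))"
proof (rule ccontr)
  define F where "F = (\<Sum>j\<in>J. a j * f (y j))"
  define E where "E = {(z, s). z \<in> U \<and> f z \<le> s}"
  define P where "P = (\<lambda>(z, s). (dist b z)\<^sup>2 + (s - F)\<^sup>2)"
  define p where "p = Inf (P ` E)"
  \<comment> \<open>\<open>V + W\<close> is the constant C of the overview: the mean squared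
    distance in the product space from \<open>(b, F)\<close> to the points
    \<open>(y j, f (y j))\<close>.\<close>
  define V where "V = (\<Sum>j\<in>J. a j * (dist b (y j))\<^sup>2)"
  define W where "W = (\<Sum>j\<in>J. a j * (f (y j) - F)\<^sup>2)"
  have P_nonneg: "0 \<le> P e" for e
    by (auto simp: P_def split: prod.split)
  have p_le: "p \<le> P e" if "e \<in> E" for e
    unfolding p_def using that P_nonneg by (intro cINF_lower bdd_belowI2[where m = 0]) auto
  have E_ne: "E \<noteq> {}"
    using U(1) by (auto simp: E_def)
  have step: "p \<le> (1 - t)\<^sup>2 * P (z, s) + t\<^sup>2 * (V + W)" if e: "(z, s) \<in> E" and t: "t \<in> {0..1}" for z s t
  proof -
    have zU: "z \<in> U" and zs: "f z \<le> s"
      using e by (auto simp: E_def)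
    have each: "p \<le> (1 - t) * (dist b z)\<^sup>2 + t * (dist b (y j))\<^sup>2 - t * (1 - t) * (dist z (y j))\<^sup>2
        + ((1 - t) * (s - F) + t * (f (y j) - F))\<^sup>2" if j: "j \<in> J" for j
    proof -
      obtain \<gamma> where \<gamma>: "geodesic \<gamma>" "\<gamma> 0 = z" "\<gamma> 1 = y j" "NPC_between z (y j) t (\<gamma> t)"
        using NPC_geodesic_exists[of z "y j"] t by metis
      then have img: "\<gamma> ` {0..1} \<subseteq> U"
        using f(2) zU U(2)[OF j] unfolding geodesically_convex_on_def geodesically_convex_def by metis
      have "f (\<gamma> t) \<le> (1 - t) * f z + t * f (y j)"
        using f(2) \<gamma> img t unfolding geodesically_convex_on_def by metis
      also have "\<dots> \<le> (1 - t) * s + t * f (y j)"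
        using zs t by (simp add: mult_left_mono)
      finally have "(\<gamma> t, (1 - t) * s + t * f (y j)) \<in> E"
        using img t by (auto simp: E_def)
      then have "p \<le> (dist b (\<gamma> t))\<^sup>2 + ((1 - t) * s + t * f (y j) - F)\<^sup>2"
        using p_le by (fastforce simp: P_def)
      moreover have "(1 - t) * s + t * f (y j) - F = (1 - t) * (s - F) + t * (f (y j) - F)"
        by (simp add: algebra_simps)
      ultimately show ?thesis
        using \<gamma>(4) unfolding NPC_between_def by (smt (verit))
    qed
    have "p = (\<Sum>j\<in>J. a j * p)"
      using a(2) by (simp flip: sum_distrib_right)
    also have "\<dots> \<le> (\<Sum>j\<in>J. a j * ((1 - t) * (dist b z)\<^sup>2 + t * (dist b (y j))\<^sup>2
        - t * (1 - t) * (dist z (y j))\<^sup>2 + ((1 - t) * (s - F) + t * (f (y j) - F))\<^sup>2))"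
      using each a(1) by (intro sum_mono mult_left_mono)
    also have "\<dots> = (\<Sum>j\<in>J. a j) * ((1 - t) * (dist b z)\<^sup>2 + (1 - t)\<^sup>2 * (s - F)\<^sup>2) + t * V
        - t * (1 - t) * (\<Sum>j\<in>J. a j * (dist z (y j))\<^sup>2)
        + 2 * (1 - t) * t * (s - F) * (\<Sum>j\<in>J. a j * (f (y j) - F)) + t\<^sup>2 * W"
      unfolding V_def W_def sum_distrib_left sum_distrib_right sum.distrib[symmetric] sum_subtractf[symmetric]
      by (intro sum.cong refl) (simp add: power2_eq_square algebra_simps)
    \<comment> \<open>\<open>F\<close> is the weighted mean of the values \<open>f (y j)\<close>, so
      the cross term vanishes.\<close>
    also have "(\<Sum>j\<in>J. a j * (f (y j) - F)) = 0"
      using a(2) by (simp add: right_diff_distrib sum_subtractf F_def flip: sum_distrib_right)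
    \<comment> \<open>The variance inequality bounds the subtracted sum from below. This lowers the
      coefficient of \<open>(dist b z)^2\<close> from \<open>1 - t\<close> to
      \<open>(1 - t)^2\<close> and that of \<open>V\<close> from \<open>t\<close> to
      \<open>t^2\<close>.\<close>
    also have "(\<Sum>j\<in>J. a j) * ((1 - t) * (dist b z)\<^sup>2 + (1 - t)\<^sup>2 * (s - F)\<^sup>2) + t * V
        - t * (1 - t) * (\<Sum>j\<in>J. a j * (dist z (y j))\<^sup>2) + 2 * (1 - t) * t * (s - F) * 0 + t\<^sup>2 * W
      \<le> ((1 - t) * (dist b z)\<^sup>2 + (1 - t)\<^sup>2 * (s - F)\<^sup>2) + t * V
        - t * (1 - t) * ((dist z b)\<^sup>2 + V) + t\<^sup>2 * W"
      unfolding a(2) V_def using t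
        mult_left_mono[OF variance_inequality[of J a b y z, OF a min], of "t * (1 - t)"]
      by simp
    also have "\<dots> = (1 - t)\<^sup>2 * P (z, s) + t\<^sup>2 * (V + W)"
      by (simp add: P_def dist_commute power2_eq_square algebra_simps)
    finally show ?thesis .
  qed
  have p_step: "p \<le> (1 - t)\<^sup>2 * p + t\<^sup>2 * (V + W)" if t: "0 < t" "t < 1" for t
  proof -
    \<comment> \<open>Solving \<open>step\<close> for \<open>P e\<close> gives the same lower bound
      at every epigraph point, hence for the infimum, attained or not.\<close>
    have "(p - t\<^sup>2 * (V + W)) / (1 - t)\<^sup>2 \<le> p"
      unfolding p_def
    proof (rule cINF_greatest[OF E_ne])
      fix e assume "e \<in> E"
      then have "p \<le> (1 - t)\<^sup>2 * P e + t\<^sup>2 * (V + W)"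
        using step t by (cases e) auto
      then show "(Inf (P ` E) - t\<^sup>2 * (V + W)) / (1 - t)\<^sup>2 \<le> P e"
        using t by (simp add: divide_le_eq p_def algebra_simps)
    qed
    then show ?thesis
      using t by (simp add: divide_le_eq algebra_simps)
  qed
  have p_bound: "(2 - t) * p \<le> t * (V + W)" if t: "0 < t" "t < 1" for t
  proof -
    \<comment> \<open>Since \<open>1 - (1 - t)^2 = t * (2 - t)\<close>, one factor \<open>t\<close>
      cancels and the limit at 0 gives \<open>2 * p <= 0\<close>.\<close>
    have "t * ((2 - t) * p) \<le> t * (t * (V + W))"
      using p_step[OF t] by (simp add: power2_eq_square algebra_simps)
    with t show ?thesis
      by simp
  qed
  have "(2 - 0) * p \<le> 0 * (V + W)"
  proof (rule tendsto_le)
    show "((\<lambda>t. t * (V + W)) \<longlongrightarrow> 0 * (V + W)) (at_right 0)"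
      "((\<lambda>t. (2 - t) * p) \<longlongrightarrow> (2 - 0) * p) (at_right 0)"
      by (intro tendsto_intros)+
    show "\<forall>\<^sub>F t in at_right 0. (2 - t) * p \<le> t * (V + W)"
      using p_bound by (auto simp: eventually_at_right_field intro!: exI[of _ 1])
  qed simp
  then have p0: "p \<le> 0"
    by simp
  assume "\<not> f b \<le> (\<Sum>j\<in>J. a j * f (y j))"
  then have "(f b - F) / 2 > 0"
    by (simp add: F_def)
  with f(1) U(1) obtain d where d: "d > 0" "\<And>z. z \<in> U \<Longrightarrow> dist z b < d \<Longrightarrow> dist (f z) (f b) < (f b - F) / 2"
    unfolding continuous_on_iff by metis
  \<comment> \<open>The first bound puts \<open>z\<close> in the ball where \<open>f z\<close> stays
    above the middle of \<open>F\<close> and \<open>f b\<close>; the second keeps \<open>s\<close>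
    below that middle. This contradicts \<open>f z <= s\<close>.\<close>
  define e where "e = min (d\<^sup>2) (((f b - F) / 2)\<^sup>2)"
  have "e > 0"
    using d(1) \<open>(f b - F) / 2 > 0\<close> by (simp add: e_def)
  with p0 have "p < e"
    by simp
  then obtain z s where zs: "(z, s) \<in> E" "P (z, s) < e"
    using E_ne by (auto simp: p_def dest!: cInf_lessD[rotated])
  then have "(dist b z)\<^sup>2 + (s - F)\<^sup>2 < d\<^sup>2" "(dist b z)\<^sup>2 + (s - F)\<^sup>2 < ((f b - F) / 2)\<^sup>2"
    by (simp_all add: P_def e_def)
  then have "(dist b z)\<^sup>2 < d\<^sup>2" "(s - F)\<^sup>2 < ((f b - F) / 2)\<^sup>2"
    using zero_le_power2[of "dist b z"] zero_le_power2[of "s - F"] by linarith+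
  then have "dist b z < d" "s - F < (f b - F) / 2"
    using power2_less_imp_less[of "dist b z" d] power2_less_imp_less[of "s - F" "(f b - F) / 2"]
      d(1) \<open>(f b - F) / 2 > 0\<close> by linarith+
  moreover from zs(1) have "z \<in> U" "f z \<le> s"
    by (auto simp: E_def)
  moreover from calculation have "\<bar>f z - f b\<bar> < (f b - F) / 2"
    using d(2) by (simp add: dist_commute dist_real_def)
  then have "f b - f z < (f b - F) / 2"
    unfolding abs_less_iff by simp
  ultimately show False
    by (simp add: field_simps)
qed

section \<open>From Jensen's inequality to majorization\<close>

theorem theorem3:
  fixes x y :: "nat \<Rightarrow> 'a::global_NPC_space"
    and lam mu :: "nat \<Rightarrow> real"
    and m n :: nat
    and U :: "'a set"
    and f :: "'a \<Rightarrow> real"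
  assumes "\<And>i. i \<in> {1..m} \<Longrightarrow> lam i \<in> {0..1}"
    and "(\<Sum>i=1..m. lam i) = 1"
    and "majorized m lam x n mu y"
    and "geodesically_convex U"
    and "\<And>i. i \<in> {1..m} \<Longrightarrow> x i \<in> U"
    and "\<And>j. j \<in> {1..n} \<Longrightarrow> y j \<in> U"
    and "continuous_on U f"
    and "geodesically_convex_on U f"
  shows "(\<Sum>i=1..m. lam i * f (x i)) \<le> (\<Sum>j=1..n. mu j * f (y j))"
proof -
  obtain a :: "nat \<Rightarrow> nat \<Rightarrow> real"
    where a: "\<And>i j. i \<in> {1..m} \<Longrightarrow> j \<in> {1..n} \<Longrightarrow> 0 \<le> a i j"
      "\<And>i. i \<in> {1..m} \<Longrightarrow> (\<Sum>j=1..n. a i j) = 1"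
      and mu: "\<And>j. j \<in> {1..n} \<Longrightarrow> mu j = (\<Sum>i=1..m. a i j * lam i)"
      and x: "\<And>i. i \<in> {1..m} \<Longrightarrow>
        is_arg_min (\<lambda>z. 1/2 * (\<Sum>j=1..n. a i j * (dist z (y j))\<^sup>2)) (\<lambda>z. z \<in> UNIV) (x i)"
    using assms(3) unfolding majorized_def by blast
  \<comment> \<open>Each row of the matrix is a probability vector with barycenter
    \<open>x i\<close>; averaging the rows with weights \<open>lam\<close> and exchanging the sums
    produces \<open>mu\<close>.\<close>
  have "f (x i) \<le> (\<Sum>j=1..n. a i j * f (y j))" if i: "i \<in> {1..m}" for i
  proof (rule NPC_Jensen)
    show "(\<Sum>j=1..n. a i j * (dist (x i) (y j))\<^sup>2) \<le> (\<Sum>j=1..n. a i j * (dist w (y j))\<^sup>2)" for w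
      using x[OF i] by (auto simp: is_arg_min_def not_less)
  qed (use a i assms in auto)
  then have "(\<Sum>i=1..m. lam i * f (x i)) \<le> (\<Sum>i=1..m. lam i * (\<Sum>j=1..n. a i j * f (y j)))"
    using assms(1) by (intro sum_mono mult_left_mono) auto
  also have "\<dots> = (\<Sum>i=1..m. \<Sum>j=1..n. a i j * lam i * f (y j))"
    by (simp add: sum_distrib_left mult_ac)
  also have "\<dots> = (\<Sum>j=1..n. \<Sum>i=1..m. a i j * lam i * f (y j))"
    by (rule sum.swap)
  also have "\<dots> = (\<Sum>j=1..n. mu j * f (y j))"
    by (simp add: mu sum_distrib_right)
  finally show ?thesis .
qed

end
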